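(* Let $m\ge2$ and let $\alpha_1,\ldots,\alpha_m>0$ be real numbers. Then $$\lim_{n\to\infty}\pi_1(\alpha_1n,\ldots,\alpha_mn)=\int_{-\infty}^\infty\prod_{k=2}^m\Big(1-\Phi\Big(\sqrt{\tfrac{\alpha_k}{\alpha_1}}\,z\Big)\Big)\frac{1}{\sqrt{2\pi}}e^{-\frac{z^2}{2}}\,dz,$$ where $n$ runs through $\mathbb{N}_{\ge1}$.
   Context: $\Phi$ is the standard normal cumulative distribution function. The function $\pi_1$ is extended to positive real arguments by $$\pi_1(x_1,\ldots,x_m)=\mathbb{P}\left(\frac{G_2}{x_2}>\frac{G_1}{x_1},\ldots,\frac{G_m}{x_m}>\frac{G_1}{x_1}\right),\qquad x_1,\ldots,x_m>0,$$ where $G_1,\ldots,G_m$ are independent with $G_j\sim\operatorname{Gamma}(x_j,1)$, i.e. $G_j$ has density $x^{x_j-1}e^{-x}/\Gamma(x_j)$ on $(0,\infty)$. (For positive integer arguments this is the probability that player 1 wins the game in which in each round exactly one player advances one step, player $\ell$ with probability $x_\ell/(x_1+\cdots+x_m)$, and the first player $\ell$ to have made $x_\ell$ steps wins.) *)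

theory Defs
  imports "HOL-Probability.Probability"
begin

(* Gamma distribution with shape a and rate 1 (meaningful for a > 0). *)
definition gamma_density :: "real \<Rightarrow> real \<Rightarrow> real" where
  "gamma_density a x = (if x > 0 then x powr (a - 1) * exp (- x) / Gamma a else 0)"

definition gamma_distribution :: "real \<Rightarrow> real measure" where
  "gamma_distribution a = density lborel (\<lambda>x. ennreal (gamma_density a x))"

(* The product measure makes the coordinates G 1, ..., G m independent with
   G j ~ Gamma(x j, 1); only the values x 1, ..., x m matter. Lemma pi1_eq_prob below
   shows that any other independent family with these laws gives the same probability. *)
definition pi1 :: "nat \<Rightarrow> (nat \<Rightarrow> real) \<Rightarrow> real" where
  "pi1 m x =
     measure (\<Pi>\<^sub>M j\<in>{1..m}. gamma_distribution (x j))
       {G \<in> space (\<Pi>\<^sub>M j\<in>{1..m}. gamma_distribution (x j)).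
          \<forall>k\<in>{2..m}. G k / x k > G 1 / x 1}"

definition Phi :: "real \<Rightarrow> real" where
  "Phi z = cdf std_normal_distribution z"

lemma gamma_density_measurable [measurable]: "gamma_density a \<in> borel_measurable borel"
  unfolding gamma_density_def [abs_def] by measurable

lemma sets_gamma_distribution [measurable_cong, simp]: "sets (gamma_distribution a) = sets borel"
  by (simp add: gamma_distribution_def)

lemma space_gamma_distribution [simp]: "space (gamma_distribution a) = UNIV"
  by (simp add: gamma_distribution_def)

lemma gamma_density_nonneg: "a > 0 \<Longrightarrow> gamma_density a x \<ge> 0"
  by (simp add: gamma_density_def Gamma_real_pos less_imp_le)

lemma prob_space_gamma_distribution:
  assumes "a > 0"
  shows "prob_space (gamma_distribution a)"
proof
  have G: "Gamma a > 0" using assms by (rule Gamma_real_pos)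
  have "((\<lambda>t. t powr (a - 1) / exp t / Gamma a) has_integral (Gamma a / Gamma a)) {0..}"
    by (intro has_integral_divide Gamma_integral_real assms)
  then have "((\<lambda>t. gamma_density a t) has_integral 1) {0..}"
    using G by (intro has_integral_spike[of "{0}" "{0..}" "gamma_density a"])
      (auto simp: gamma_density_def exp_minus field_simps)
  then have "(gamma_density a has_integral 1) UNIV"
    by (rule has_integral_on_superset) (auto simp: gamma_density_def)
  then have "(\<integral>\<^sup>+ x. ennreal (gamma_density a x) \<partial>lborel) = 1"
    using nn_integral_has_integral_lborel[of "gamma_density a" 1] gamma_density_nonneg[OF assms]
    by simp
  then show "emeasure (gamma_distribution a) (space (gamma_distribution a)) = 1"
    by (simp add: gamma_distribution_def emeasure_density)
qed

lemma (in prob_space) pi1_eq_prob: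
  fixes G :: "nat \<Rightarrow> 'a \<Rightarrow> real"
  assumes m: "m \<ge> 1"
    and ind: "indep_vars (\<lambda>_. borel) G {1..m}"
    and law: "\<And>j. j \<in> {1..m} \<Longrightarrow> distributed M lborel (G j) (\<lambda>t. ennreal (gamma_density (x j) t))"
  shows "prob {\<omega> \<in> space M. \<forall>k\<in>{2..m}. G k \<omega> / x k > G 1 \<omega> / x 1} = pi1 m x"
proof -
  let ?P = "\<Pi>\<^sub>M j\<in>{1..m}. gamma_distribution (x j)"
  let ?X = "\<lambda>\<omega>. \<lambda>j\<in>{1..m}. G j \<omega>"
  let ?B = "{g \<in> space ?P. \<forall>k\<in>{2..m}. g k / x k > g 1 / x 1}"
  have rv: "random_variable borel (G j)" if "j \<in> {1..m}" for j
    using ind that unfolding indep_vars_def by blast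
  have d: "distr M borel (G j) = gamma_distribution (x j)" if "j \<in> {1..m}" for j
  proof -
    have "distr M borel (G j) = distr M lborel (G j)" by (rule distr_cong) auto
    with distributed_distr_eq_density[OF law[OF that]] show ?thesis
      by (simp add: gamma_distribution_def)
  qed
  have "distr M (\<Pi>\<^sub>M j\<in>{1..m}. borel) ?X = (\<Pi>\<^sub>M j\<in>{1..m}. distr M borel (G j))"
    using indep_vars_iff_distr_eq_PiM'[of "{1..m}" G "\<lambda>_. borel"] m rv ind by auto
  also have "\<dots> = ?P" by (rule PiM_cong) (auto simp: d)
  finally have P: "distr M (\<Pi>\<^sub>M j\<in>{1..m}. borel) ?X = ?P" .
  have X: "?X \<in> measurable M (\<Pi>\<^sub>M j\<in>{1..m}. borel)" by (rule measurable_restrict) (rule rv)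
  have sp: "space ?P = space (\<Pi>\<^sub>M j\<in>{1..m}. (borel :: real measure))"
    by (simp add: space_PiM)
  have "{g \<in> space (\<Pi>\<^sub>M j\<in>{1..m}. (borel :: real measure)). \<forall>k\<in>{2..m}. g k / x k > g 1 / x 1}
      \<in> sets (\<Pi>\<^sub>M j\<in>{1..m}. borel)"
  proof (rule sets.sets_Collect_finite_All)
    fix k assume k: "k \<in> {2..m}"
    have 1: "(\<lambda>g. g k / x k) \<in> borel_measurable (\<Pi>\<^sub>M j\<in>{1..m}. (borel :: real measure))"
      using k by (intro borel_measurable_divide measurable_component_singleton borel_measurable_const) auto
    have 2: "(\<lambda>g. g 1 / x 1) \<in> borel_measurable (\<Pi>\<^sub>M j\<in>{1..m}. (borel :: real measure))"
      using m by (intro borel_measurable_divide measurable_component_singleton borel_measurable_const) auto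
    show "{g \<in> space (\<Pi>\<^sub>M j\<in>{1..m}. (borel :: real measure)). g k / x k > g 1 / x 1}
      \<in> sets (\<Pi>\<^sub>M j\<in>{1..m}. borel)"
      by (rule borel_measurable_less[OF 2 1])
  qed simp
  then have B: "?B \<in> sets (\<Pi>\<^sub>M j\<in>{1..m}. borel)" by (simp only: sp)
  have "pi1 m x = measure (distr M (\<Pi>\<^sub>M j\<in>{1..m}. borel) ?X) ?B"
    unfolding pi1_def P ..
  also have "\<dots> = prob (?X -` ?B \<inter> space M)" by (rule measure_distr[OF X B])
  also have "?X -` ?B \<inter> space M = {\<omega> \<in> space M. \<forall>k\<in>{2..m}. G k \<omega> / x k > G 1 \<omega> / x 1}"
    using m by (auto simp: sp space_PiM)
  finally show ?thesis ..
qed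

end

theory Submission
  imports Defs "HOL-Real_Asymp.Real_Asymp" begin

text \<open>If \<open>G\<close> has the Gamma distribution with shape \<open>a\<close>, then \<open>W = sqrt a * ln (G / a)\<close> has a density
  proportional to \<open>exp (- a (e\<^sup>u - 1 - u))\<close> with \<open>u = w / sqrt a\<close>. These kernels tend to
  \<open>exp (- w\<^sup>2 / 2)\<close> and are all bounded by \<open>exp (2 - \<bar>w\<bar>)\<close> for \<open>a \<ge> 1\<close>, so dominated convergence gives
  first the normalising constant, then the convergence of the distribution functions to \<open>Phi\<close>.
  The logarithm turns \<open>G\<^sub>k / x\<^sub>k > G\<^sub>1 / x\<^sub>1\<close> into the linear condition
  \<open>W\<^sub>k > sqrt (x\<^sub>k / x\<^sub>1) * W\<^sub>1\<close>; by Fubini, \<open>pi1\<close> is therefore an integral of a product of tail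
  probabilities against the law of \<open>W\<^sub>1\<close>, and dominated convergence applies once more.\<close>

section \<open>The law of the rescaled logarithm of a Gamma variable\<close>

definition log_gamma_kernel :: "real \<Rightarrow> real \<Rightarrow> real" where
  "log_gamma_kernel a w = exp (- (a * (exp (w / sqrt a) - 1 - w / sqrt a)))"

text \<open>The Stirling ratio: what remains of the density of \<open>W\<close> once the kernel,
  normalised to be 1 at \<open>w = 0\<close>, is split off.\<close>

definition log_gamma_const :: "real \<Rightarrow> real" where
  "log_gamma_const a = a powr (a - 1/2) * exp (- a) / Gamma a"

definition log_gamma_density :: "real \<Rightarrow> real \<Rightarrow> real" where
  "log_gamma_density a w = log_gamma_const a * log_gamma_kernel a w"

definition log_gamma_distribution :: "real \<Rightarrow> real measure" where
  "log_gamma_distribution a = density lborel (\<lambda>w. ennreal (log_gamma_density a w))"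

lemma log_gamma_kernel_measurable [measurable]: "log_gamma_kernel a \<in> borel_measurable borel"
  unfolding log_gamma_kernel_def [abs_def] by measurable

lemma log_gamma_density_measurable [measurable]: "log_gamma_density a \<in> borel_measurable borel"
  unfolding log_gamma_density_def [abs_def] by measurable

lemma sets_log_gamma_distribution [measurable_cong, simp]:
  "sets (log_gamma_distribution a) = sets borel"
  by (simp add: log_gamma_distribution_def)

lemma space_log_gamma_distribution [simp]: "space (log_gamma_distribution a) = UNIV"
  by (simp add: log_gamma_distribution_def)

lemma log_gamma_const_pos: "a > 0 \<Longrightarrow> log_gamma_const a > 0"
  by (simp add: log_gamma_const_def Gamma_real_pos)

lemma log_gamma_density_nonneg: "a > 0 \<Longrightarrow> log_gamma_density a w \<ge> 0"
  using log_gamma_const_pos[of a] by (simp add: log_gamma_density_def log_gamma_kernel_def)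

text \<open>Change of variables for densities: the last factor is the derivative of
  \<open>a * exp (w / sqrt a)\<close> in \<open>w\<close>. Splitting off \<open>exp (- a)\<close>
  leaves the exponent \<open>exp u - 1 - u\<close>, whose Taylor expansion at 0 starts with the
  quadratic term.\<close>

lemma log_gamma_density_eq:
  assumes "a > 0"
  shows "log_gamma_density a w =
    gamma_density a (a * exp (w / sqrt a)) * (a * exp (w / sqrt a) / sqrt a)"
proof -
  define u where "u = w / sqrt a"
  have 1: "(a * exp u) powr (a - 1) = a powr (a - 1) * exp ((a - 1) * u)"
    using assms by (simp add: powr_def ln_mult algebra_simps flip: exp_add)
  have 2: "a powr (a - 1/2) = a powr (a - 1) * (a / sqrt a)"
  proof -
    have "a powr (a - 1/2) = a powr (a - 1) * a powr (1/2)"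
      by (simp flip: powr_add)
    also have "a powr (1/2) = a / sqrt a"
      using assms by (simp add: powr_half_sqrt real_div_sqrt)
    finally show ?thesis .
  qed
  have 3: "exp (- a) * exp (- (a * (exp u - 1 - u))) = exp ((a - 1) * u) * exp (- (a * exp u)) * exp u"
    by (simp flip: exp_add add: algebra_simps)
  have "log_gamma_density a w =
      a powr (a - 1/2) * (exp (- a) * exp (- (a * (exp u - 1 - u)))) / Gamma a"
    by (simp add: log_gamma_density_def log_gamma_const_def log_gamma_kernel_def u_def)
  also have "\<dots> = gamma_density a (a * exp u) * (a * exp u / sqrt a)"
    unfolding 2 3 using assms by (simp add: gamma_density_def 1 mult_ac)
  finally show ?thesis by (simp add: u_def)
qed

text \<open>The map is a smooth bijection from the real line onto the positive half-line, so the
  change of variables theorem applies to the Gamma density times the indicator of any Borel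
  set.\<close>

lemma gamma_distribution_eq_distr:
  assumes "a > 0"
  shows "gamma_distribution a =
    distr (log_gamma_distribution a) borel (\<lambda>w. a * exp (w / sqrt a))"
proof (rule measure_eqI)
  show "sets (gamma_distribution a) =
      sets (distr (log_gamma_distribution a) borel (\<lambda>w. a * exp (w / sqrt a)))"
    by simp
next
  fix B assume "B \<in> sets (gamma_distribution a)"
  then have [measurable]: "B \<in> sets borel" by simp
  let ?g = "\<lambda>w. a * exp (w / sqrt a)"
  let ?f = "\<lambda>y. gamma_density a y * indicator B y :: real"
  let ?h = "\<lambda>w. \<bar>a * exp (w / sqrt a) / sqrt a\<bar> * ?f (?g w)"
  interpret G: prob_space "gamma_distribution a"
    by (rule prob_space_gamma_distribution) fact
  have f_nn: "?f y \<ge> 0" for y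
    by (simp add: gamma_density_nonneg assms)
  have g_eq: "emeasure (gamma_distribution a) B = (\<integral>\<^sup>+y. ennreal (?f y) \<partial>lborel)"
    unfolding gamma_distribution_def
    by (subst emeasure_density) (auto intro!: nn_integral_cong split: split_indicator)
  have f_int: "integrable lborel ?f"
  proof (rule integrableI_nonneg)
    show "(\<integral>\<^sup>+y. ennreal (?f y) \<partial>lborel) < \<infinity>"
      unfolding g_eq[symmetric] by (simp add: G.emeasure_eq_measure)
  qed (use f_nn in auto)
  have f_abs: "?f absolutely_integrable_on UNIV"
    using f_int by (simp add: integrable_completion set_integrable_def)
  have range: "range ?g = {0 :: real<..}"
  proof (intro equalityI subsetI)
    fix y assume "y \<in> {0 :: real<..}"
    then have "y = ?g (sqrt a * ln (y / a))"
      using assms by simp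
    then show "y \<in> range ?g" by blast
  qed (use assms in auto)
  have inj: "inj ?g"
    using assms by (auto intro!: injI)
  have deriv: "(?g has_field_derivative a * exp (w / sqrt a) / sqrt a) (at w)" for w
    using assms by (auto intro!: derivative_eq_intros simp: field_simps)
  \<comment> \<open>The theorem is an equivalence about an arbitrary value of the integral. Taking
    that value to be the integral of \<open>?f\<close> itself makes the second conjunct on the right
    trivial, so only integrability of \<open>?f\<close> remains to be shown.\<close>
  have "?h absolutely_integrable_on UNIV \<and> integral UNIV ?h = integral {0 :: real<..} ?f \<longleftrightarrow>
      ?f absolutely_integrable_on {0 :: real<..} \<and> integral {0 :: real<..} ?f = integral {0 :: real<..} ?f"
    unfolding range[symmetric]
    by (intro has_absolute_integral_change_of_variables_1')
      (auto simp: deriv inj)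
  moreover have "?f absolutely_integrable_on {0 :: real<..}"
    by (rule set_integrable_subset[OF f_abs]) auto
  ultimately have h_abs: "?h absolutely_integrable_on UNIV"
    and h_eq: "integral UNIV ?h = integral {0 :: real<..} ?f"
    by auto
  have h_nn: "?h w \<ge> 0" for w
    by (simp add: gamma_density_nonneg assms)
  have h_int: "integrable lborel ?h"
    using h_abs by (simp add: integrable_completion set_integrable_def)
  have "(\<integral>\<^sup>+y. ennreal (?f y) \<partial>lborel) = ennreal (integral UNIV ?f)"
    using f_nn by (simp add: nn_integral_eq_integral f_int integral_lborel)
  also have "integral UNIV ?f = integral {0 :: real<..} ?f"
    by (rule integral_spike_set) (auto simp: gamma_density_def)
  also have "ennreal \<dots> = (\<integral>\<^sup>+w. ennreal (?h w) \<partial>lborel)"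
    unfolding h_eq[symmetric] integral_lborel[OF h_int]
    by (rule nn_integral_eq_integral[OF h_int AE_I2[OF h_nn], symmetric])
  also have "\<dots> = (\<integral>\<^sup>+w. ennreal (log_gamma_density a w) * indicator (?g -` B) w \<partial>lborel)"
    using assms by (intro nn_integral_cong)
      (auto simp: log_gamma_density_eq mult_ac abs_mult split: split_indicator)
  also have "\<dots> = emeasure (log_gamma_distribution a) (?g -` B)"
    using measurable_sets[of ?g borel borel B] unfolding log_gamma_distribution_def
    by (subst emeasure_density) auto
  also have "\<dots> = emeasure (distr (log_gamma_distribution a) borel ?g) B"
    by (simp add: emeasure_distr)
  finally show "emeasure (gamma_distribution a) B =
      emeasure (distr (log_gamma_distribution a) borel ?g) B"
    by (simp add: g_eq)
qed

text \<open>Total mass is preserved by push-forward, so it is inherited from the Gamma law.\<close>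

lemma prob_space_log_gamma_distribution:
  assumes "a > 0"
  shows "prob_space (log_gamma_distribution a)"
proof (rule prob_space_distrD)
  show "(\<lambda>w. a * exp (w / sqrt a)) \<in> measurable (log_gamma_distribution a) borel"
    by simp
  show "prob_space (distr (log_gamma_distribution a) borel (\<lambda>w. a * exp (w / sqrt a)))"
    using prob_space_gamma_distribution[OF assms] gamma_distribution_eq_distr[OF assms] by simp
qed

section \<open>Domination and pointwise limit of the kernels\<close>

lemma integrable_exp_minus_abs: "integrable lborel (\<lambda>x :: real. exp (- \<bar>x\<bar>))"
proof -
  interpret E: prob_space "density lborel (exponential_density 1)"
    by (rule prob_space_exponential_density) simp
  have e: "integrable lborel (exponential_density 1)"
  proof (rule integrableI_nonneg)
    show "(\<integral>\<^sup>+x. ennreal (exponential_density 1 x) \<partial>lborel) < \<infinity>"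
      using E.emeasure_space_1 by (simp add: emeasure_density)
  qed (auto simp: exponential_density_nonneg)
  have e': "integrable lborel (\<lambda>x. exponential_density 1 (- x))"
    using lborel_integrable_real_affine[OF e, of "- 1" 0] by simp
  show ?thesis
    by (rule Bochner_Integration.integrable_bound[OF Bochner_Integration.integrable_add[OF e e']])
      (auto simp: exponential_density_def)
qed

text \<open>Clearing the denominator leaves \<open>(2 + v) * exp (- v) + v \<ge> 2\<close>, an
  equality at 0 with increasing left side. The bound is quadratic near 0 and linear at infinity, as
  the left tail of the kernel requires: there the exponent grows only linearly.\<close>

lemma exp_minus_ge:
  fixes v :: real
  assumes "v \<ge> 0"
  shows "exp (- v) - 1 + v \<ge> v\<^sup>2 / (2 + v)"
proof -
  have "(2 + 0) * exp (- 0) + 0 \<le> (2 + v) * exp (- v) + v"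
  proof (rule DERIV_nonneg_imp_nondecreasing[OF assms])
    fix x :: real assume "0 \<le> x"
    have "((\<lambda>x. (2 + x) * exp (- x) + x) has_real_derivative 1 - (1 + x) * exp (- x)) (at x)"
      by (auto intro!: derivative_eq_intros simp: algebra_simps)
    moreover have "(1 + x) * exp (- x) \<le> 1"
      using exp_ge_add_one_self[of x] by (simp add: exp_minus field_simps)
    ultimately show "\<exists>y. ((\<lambda>x. (2 + x) * exp (- x) + x) has_real_derivative y) (at x) \<and> 0 \<le> y"
      by (intro exI[of _ "1 - (1 + x) * exp (- x)"]) auto
  qed
  then show ?thesis
    using assms by (simp add: field_simps power2_eq_square)
qed

text \<open>Taking logarithms, the exponent must be at least \<open>\<bar>w\<bar> - 2\<close>. For
  \<open>u \<ge> 0\<close> the quadratic Taylor bound gives this, for \<open>u < 0\<close> the bound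
  of \<open>exp_minus_ge\<close>.\<close>

lemma log_gamma_kernel_le:
  assumes "a \<ge> 1"
  shows "log_gamma_kernel a w \<le> exp 2 * exp (- \<bar>w\<bar>)"
proof -
  define u where "u = w / sqrt a"
  have w: "w = sqrt a * u" using assms by (simp add: u_def)
  have w2: "w\<^sup>2 = a * u\<^sup>2" using assms by (simp add: w power_mult_distrib)
  have "\<bar>w\<bar> - 2 \<le> a * (exp u - 1 - u)"
  proof (cases "u \<ge> 0")
    case True
    have "0 \<le> (w - 1)\<^sup>2" by simp
    then have "w - 2 \<le> w\<^sup>2 / 2"
      by (simp add: power2_eq_square algebra_simps)
    also have "\<dots> = a * (u\<^sup>2 / 2)"
      by (simp add: w2)
    also have "\<dots> \<le> a * (exp u - 1 - u)"
      using exp_lower_Taylor_quadratic[OF True] assms by (intro mult_left_mono) auto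
    finally show ?thesis using True assms by (simp add: w)
  next
    case False
    define v where "v = - u"
    \<comment> \<open>Since \<open>sqrt a \<ge> 1\<close>, passing from \<open>w\<close> to
      \<open>v\<close> does not increase the absolute value; this makes the bound uniform in
      \<open>a\<close>.\<close>
    have v: "v \<ge> 0" "v \<le> \<bar>w\<bar>" "w\<^sup>2 = a * v\<^sup>2"
      using False assms w2 by (auto simp: v_def w abs_mult mult_le_cancel_right1)
    \<comment> \<open>The product of \<open>\<bar>w\<bar> - 2\<close> and
      \<open>\<bar>w\<bar> + 2\<close> is \<open>w\<^sup>2 - 4\<close>; this is where the constant 2
      comes from.\<close>
    have "\<bar>w\<bar> - 2 \<le> w\<^sup>2 / (2 + \<bar>w\<bar>)"
      by (simp add: field_simps power2_eq_square)
    also have "\<dots> \<le> w\<^sup>2 / (2 + v)"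
      using v(1,2) by (intro divide_left_mono) auto
    also have "\<dots> = a * (v\<^sup>2 / (2 + v))"
      by (simp add: v)
    also have "\<dots> \<le> a * (exp (- v) - 1 + v)"
      using exp_minus_ge[OF v(1)] assms by (intro mult_left_mono) auto
    finally show ?thesis by (simp add: v_def)
  qed
  then show ?thesis
    by (simp add: log_gamma_kernel_def u_def flip: exp_add)
qed

lemma log_gamma_kernel_tendsto:
  "((\<lambda>a. log_gamma_kernel a w) \<longlongrightarrow> exp (- (w\<^sup>2 / 2))) at_top"
proof -
  have "((\<lambda>a. a * (exp (w / sqrt a) - 1 - w / sqrt a)) \<longlongrightarrow> w * w / 2) at_top"
    \<comment> \<open>The three cases fix the sign of the parameter \<open>w\<close> for
      \<open>real_asymp\<close>.\<close>
    by (cases w "0 :: real" rule: linorder_cases) (real_asymp | simp)+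
  then show ?thesis
    unfolding log_gamma_kernel_def power2_eq_square by (intro tendsto_intros)
qed

section \<open>Limits of integrals and of the normalising constant\<close>

text \<open>The test function may vary with \<open>t\<close>. It will be a constant for the
  normalising factor, an indicator for the distribution functions, and a product of tail
  probabilities for \<open>pi1\<close>.\<close>

lemma tendsto_integral_log_gamma_kernel:
  fixes h :: "real \<Rightarrow> real \<Rightarrow> real"
  assumes [measurable]: "\<And>t. h t \<in> borel_measurable borel" "h0 \<in> borel_measurable borel"
    and \<alpha>: "\<alpha> > 0"
    and bound: "eventually (\<lambda>t. \<forall>w. \<bar>h t w\<bar> \<le> 1) at_top"
    and lim: "\<And>w. ((\<lambda>t. h t w) \<longlongrightarrow> h0 w) at_top"
  shows "((\<lambda>t. \<integral>w. log_gamma_kernel (\<alpha> * t) w * h t w \<partial>lborel) \<longlongrightarrow>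
    (\<integral>w. exp (- (w\<^sup>2 / 2)) * h0 w \<partial>lborel)) at_top"
proof (rule integral_dominated_convergence_at_top)
  have \<alpha>t: "filterlim (\<lambda>t. \<alpha> * t) at_top at_top"
    by (intro filterlim_tendsto_pos_mult_at_top[OF tendsto_const \<alpha>] filterlim_ident)
  show "integrable lborel (\<lambda>w :: real. exp 2 * exp (- \<bar>w\<bar>))"
    by (intro integrable_mult_right integrable_exp_minus_abs)
  show "AE w in lborel. ((\<lambda>t. log_gamma_kernel (\<alpha> * t) w * h t w) \<longlongrightarrow>
      exp (- (w\<^sup>2 / 2)) * h0 w) at_top"
    by (intro AE_I2 tendsto_mult lim filterlim_compose[OF log_gamma_kernel_tendsto \<alpha>t])
  have "eventually (\<lambda>t. \<alpha> * t \<ge> 1) at_top"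
    using \<alpha>t by (simp add: filterlim_at_top)
  then show "eventually (\<lambda>t. AE w in lborel.
      norm (log_gamma_kernel (\<alpha> * t) w * h t w) \<le> exp 2 * exp (- \<bar>w\<bar>)) at_top"
    using bound
  proof eventually_elim
    case (elim t)
    have "\<bar>log_gamma_kernel (\<alpha> * t) w\<bar> * \<bar>h t w\<bar> \<le> exp 2 * exp (- \<bar>w\<bar>) * 1" for w
      using log_gamma_kernel_le[OF elim(1), of w] elim(2)
      by (intro mult_mono) (auto simp: log_gamma_kernel_def)
    then show ?case by (simp add: abs_mult)
  qed
qed measurable

lemma integral_log_gamma_distribution:
  assumes "a > 0" and [measurable]: "f \<in> borel_measurable borel"
  shows "(\<integral>w. f w \<partial>log_gamma_distribution a) =
    log_gamma_const a * (\<integral>w. log_gamma_kernel a w * f w \<partial>lborel)"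
  unfolding log_gamma_distribution_def
  by (subst integral_density)
    (auto simp: log_gamma_density_nonneg[unfolded log_gamma_density_def] assms log_gamma_density_def mult.assoc)

text \<open>This is Stirling's formula for the Gamma function.\<close>
lemma log_gamma_const_tendsto: "(log_gamma_const \<longlongrightarrow> 1 / sqrt (2 * pi)) at_top"
proof -
  let ?I = "\<lambda>a. \<integral>w. log_gamma_kernel a w \<partial>lborel"
  have "(1 / sqrt (2 * pi)) * (\<integral>w. exp (- (w\<^sup>2 / 2)) \<partial>lborel) =
      (\<integral>w. std_normal_density w \<partial>lborel)"
    by (simp add: std_normal_density_def)
  then have I: "(\<integral>w. exp (- (w\<^sup>2 / 2)) \<partial>lborel) = sqrt (2 * pi)"
    by (simp add: field_simps)
  have "(?I \<longlongrightarrow> sqrt (2 * pi)) at_top"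
    using tendsto_integral_log_gamma_kernel[of "\<lambda>_ _. 1" "\<lambda>_. 1" 1] I by simp
  then have "((\<lambda>a. 1 / ?I a) \<longlongrightarrow> 1 / sqrt (2 * pi)) at_top"
    by (intro tendsto_intros) auto
  \<comment> \<open>Total mass 1 makes the constant the reciprocal of the kernel integral, so no
    separate asymptotics of \<open>Gamma\<close> enter.\<close>
  moreover have "eventually (\<lambda>a. 1 / ?I a = log_gamma_const a) at_top"
    using eventually_gt_at_top[of 0]
  proof eventually_elim
    case (elim a)
    interpret prob_space "log_gamma_distribution a"
      by (rule prob_space_log_gamma_distribution) fact
    have "log_gamma_const a * ?I a = 1"
      using integral_log_gamma_distribution[OF elim, of "\<lambda>_. 1"] prob_space by simp
    moreover from this have "?I a \<noteq> 0" by auto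
    ultimately show ?case
      by (simp add: divide_eq_eq)
  qed
  ultimately show ?thesis
    by (rule Lim_transform_eventually)
qed

text \<open>Convergence of the laws to the standard normal one, tested on bounded functions that may
  be discontinuous and may depend on \<open>t\<close>.\<close>

lemma tendsto_integral_log_gamma_distribution:
  fixes h :: "real \<Rightarrow> real \<Rightarrow> real"
  assumes [measurable]: "\<And>t. h t \<in> borel_measurable borel" "h0 \<in> borel_measurable borel"
    and \<alpha>: "\<alpha> > 0"
    and "eventually (\<lambda>t. \<forall>w. \<bar>h t w\<bar> \<le> 1) at_top"
    and "\<And>w. ((\<lambda>t. h t w) \<longlongrightarrow> h0 w) at_top"
  shows "((\<lambda>t. \<integral>w. h t w \<partial>log_gamma_distribution (\<alpha> * t)) \<longlongrightarrow>
    (\<integral>w. h0 w * std_normal_density w \<partial>lborel)) at_top"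
proof -
  have \<alpha>t: "filterlim (\<lambda>t. \<alpha> * t) at_top at_top"
    by (intro filterlim_tendsto_pos_mult_at_top[OF tendsto_const \<alpha>] filterlim_ident)
  have "((\<lambda>t. log_gamma_const (\<alpha> * t) * (\<integral>w. log_gamma_kernel (\<alpha> * t) w * h t w \<partial>lborel)) \<longlongrightarrow>
      1 / sqrt (2 * pi) * (\<integral>w. exp (- (w\<^sup>2 / 2)) * h0 w \<partial>lborel)) at_top"
    by (intro tendsto_mult filterlim_compose[OF log_gamma_const_tendsto \<alpha>t]
        tendsto_integral_log_gamma_kernel assms)
  also have "1 / sqrt (2 * pi) * (\<integral>w. exp (- (w\<^sup>2 / 2)) * h0 w \<partial>lborel) =
      (\<integral>w. 1 / sqrt (2 * pi) * (exp (- (w\<^sup>2 / 2)) * h0 w) \<partial>lborel)"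
    by simp
  also have "\<dots> = (\<integral>w. h0 w * std_normal_density w \<partial>lborel)"
    by (intro Bochner_Integration.integral_cong) (auto simp: std_normal_density_def)
  finally show ?thesis
  proof (rule Lim_transform_eventually)
    show "eventually (\<lambda>t. log_gamma_const (\<alpha> * t) *
        (\<integral>w. log_gamma_kernel (\<alpha> * t) w * h t w \<partial>lborel) =
        (\<integral>w. h t w \<partial>log_gamma_distribution (\<alpha> * t))) at_top"
      using eventually_gt_at_top[of 0]
      by eventually_elim (simp add: integral_log_gamma_distribution \<alpha>)
  qed
qed

section \<open>Convergence of the distribution functions\<close>

lemma real_distribution_log_gamma_distribution:
  "a > 0 \<Longrightarrow> real_distribution (log_gamma_distribution a)"
  by (simp add: real_distribution_def real_distribution_axioms_def prob_space_log_gamma_distribution)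

lemma Phi_eq_integral: "Phi z = (\<integral>w. indicator {..z} w * std_normal_density w \<partial>lborel)"
proof -
  interpret real_distribution std_normal_distribution
    by (rule real_dist_normal_dist)
  have "Phi z = (\<integral>w. indicator {..z} w \<partial>std_normal_distribution)"
    by (simp add: Phi_def cdf_def)
  also have "\<dots> = (\<integral>w. indicator {..z} w * std_normal_density w \<partial>lborel)"
    by (subst integral_density) (auto simp: mult_ac)
  finally show ?thesis .
qed

lemma Phi_measurable [measurable]: "Phi \<in> borel_measurable borel"
proof -
  interpret real_distribution std_normal_distribution
    by (rule real_dist_normal_dist)
  show ?thesis
    by (intro borel_measurable_mono monoI) (simp add: Phi_def cdf_nondecreasing)
qed

text \<open>The indicator of a half-line is an admissible test function, so no approximation by
  continuous functions is needed.\<close>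

lemma cdf_log_gamma_distribution_tendsto:
  assumes "\<alpha> > 0"
  shows "((\<lambda>t. cdf (log_gamma_distribution (\<alpha> * t)) z) \<longlongrightarrow> Phi z) at_top"
proof -
  have "((\<lambda>t. \<integral>w. indicator {..z} w \<partial>log_gamma_distribution (\<alpha> * t)) \<longlongrightarrow> Phi z) at_top"
    unfolding Phi_eq_integral using assms
    by (intro tendsto_integral_log_gamma_distribution) (auto split: split_indicator)
  then show ?thesis by (simp add: cdf_def)
qed

section \<open>Conditioning on the first coordinate\<close>

text \<open>Once coordinate \<open>i\<close> is fixed at \<open>y\<close>, the conditions concern
  distinct independent coordinates, so the conditional event is a product set. Fubini with
  \<open>y\<close> as the outer variable then gives the formula.\<close>

lemma (in product_prob_space) measure_PiM_insert_Collect: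
  assumes J: "finite J" "i \<notin> J"
    and Q: "\<And>k. k \<in> J \<Longrightarrow> Q k \<in> sets (M i \<Otimes>\<^sub>M M k)"
  shows "measure (\<Pi>\<^sub>M j\<in>insert i J. M j)
      {G \<in> space (\<Pi>\<^sub>M j\<in>insert i J. M j). \<forall>k\<in>J. (G i, G k) \<in> Q k} =
    (\<integral>y. (\<Prod>k\<in>J. measure (M k) (Pair y -` Q k)) \<partial>M i)"
proof -
  let ?P = "\<Pi>\<^sub>M j\<in>insert i J. M j"
  let ?A = "{G \<in> space ?P. \<forall>k\<in>J. (G i, G k) \<in> Q k}"
  have A [measurable]: "?A \<in> sets ?P"
  proof (rule sets.sets_Collect_finite_All)
    fix k assume k: "k \<in> J"
    have "(\<lambda>G. (G i, G k)) \<in> measurable ?P (M i \<Otimes>\<^sub>M M k)"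
      using k by (intro measurable_Pair measurable_component_singleton) auto
    from measurable_sets[OF this Q[OF k]]
    show "{G \<in> space ?P. (G i, G k) \<in> Q k} \<in> sets ?P"
      by (simp add: vimage_def Int_def conj_commute)
  qed (rule J)
  have Qy: "Pair y -` Q k \<in> sets (M k)" if "k \<in> J" for y k
    by (rule sets_Pair1) (rule Q[OF that])
  have "emeasure ?P ?A = (\<integral>\<^sup>+G. indicator ?A G \<partial>?P)"
    by simp
  also have "\<dots> = (\<integral>\<^sup>+y. \<integral>\<^sup>+x. indicator ?A (x(i := y)) \<partial>Pi\<^sub>M J M \<partial>M i)"
    by (rule product_nn_integral_insert_rev[OF J]) measurable
  also have "\<dots> = (\<integral>\<^sup>+y. \<integral>\<^sup>+x. (\<Prod>k\<in>J. indicator (Pair y -` Q k) (x k)) \<partial>Pi\<^sub>M J M \<partial>M i)"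
  proof (intro nn_integral_cong)
    fix y x assume yx: "y \<in> space (M i)" "x \<in> space (Pi\<^sub>M J M)"
    have ne: "k \<noteq> i" if "k \<in> J" for k using that J by auto
    have "x(i := y) \<in> space ?P"
      using yx by (auto simp: space_PiM PiE_def extensional_def)
    then have "x(i := y) \<in> ?A \<longleftrightarrow> (\<forall>k\<in>J. x k \<in> Pair y -` Q k)"
      using ne by auto
    then show "(indicator ?A (x(i := y)) :: ennreal) = (\<Prod>k\<in>J. indicator (Pair y -` Q k) (x k))"
      using J(1) by (auto simp: indicator_def prod_zero_iff intro!: prod.neutral[symmetric])
  qed
  also have "\<dots> = (\<integral>\<^sup>+y. (\<Prod>k\<in>J. emeasure (M k) (Pair y -` Q k)) \<partial>M i)"
    using J(1) Qy by (intro nn_integral_cong) (subst product_nn_integral_prod, auto)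
  also have "\<dots> = (\<integral>\<^sup>+y. ennreal (\<Prod>k\<in>J. measure (M k) (Pair y -` Q k)) \<partial>M i)"
    by (simp add: M.emeasure_eq_measure prod_ennreal)
  finally have "emeasure ?P ?A = \<dots>" .
  moreover have "(\<lambda>y. \<Prod>k\<in>J. measure (M k) (Pair y -` Q k)) \<in> borel_measurable (M i)"
    unfolding measure_def
    by (intro borel_measurable_prod borel_measurable_enn2real M.measurable_emeasure_Pair Q)
  ultimately show ?thesis
    by (subst integral_eq_nn_integral) (auto simp: measure_def intro!: AE_I2 prod_nonneg)
qed

lemma pi1_eq_integral_cdf:
  assumes m: "m \<ge> 1" and x: "\<And>j. j \<in> {1..m} \<Longrightarrow> x j > 0"
  shows "pi1 m x = (\<integral>w. (\<Prod>k=2..m. 1 - cdf (log_gamma_distribution (x k)) (sqrt (x k / x 1) * w))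
    \<partial>log_gamma_distribution (x 1))"
proof -
  \<comment> \<open>The locale asks for a probability measure at every index, while
    \<open>x j > 0\<close> is known only on \<open>{1..m}\<close>; elsewhere a point mass serves as
    a default.\<close>
  define M where "M j = (if j \<in> {1..m} then gamma_distribution (x j) else return borel 0)" for j
  have M: "M j = gamma_distribution (x j)" if "j \<in> {1..m}" for j
    using that by (simp add: M_def)
  have ps: "prob_space (M j)" for j
    using prob_space_gamma_distribution[OF x] by (auto simp: M_def intro: prob_space_return)
  interpret product_prob_space M "{1..m}"
    using ps by (simp add: product_prob_space_def product_prob_space_axioms_def
        product_sigma_finite_def prob_space_imp_sigma_finite)
  define Q where "Q k = {p :: real \<times> real. snd p / x k > fst p / x 1}" for k
  have x1: "x 1 > 0" and M1: "M 1 = gamma_distribution (x 1)"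
    using m by (auto intro: x M)
  have Qs: "Q k \<in> sets (borel \<Otimes>\<^sub>M borel)" for k
  proof -
    have "{p \<in> space (borel \<Otimes>\<^sub>M borel). snd p / x k > fst p / x 1} \<in> sets (borel \<Otimes>\<^sub>M borel)"
      by measurable
    then show ?thesis by (simp add: Q_def space_pair_measure)
  qed
  have PM: "(\<Pi>\<^sub>M j\<in>{1..m}. gamma_distribution (x j)) = (\<Pi>\<^sub>M j\<in>insert 1 {2..m}. M j)"
    using m by (intro PiM_cong) (auto simp: M)
  have "pi1 m x = (\<integral>y. (\<Prod>k=2..m. measure (M k) (Pair y -` Q k)) \<partial>M 1)"
  proof -
    have "pi1 m x = measure (\<Pi>\<^sub>M j\<in>insert 1 {2..m}. M j)
        {G \<in> space (\<Pi>\<^sub>M j\<in>insert 1 {2..m}. M j). \<forall>k\<in>{2..m}. (G 1, G k) \<in> Q k}"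
      unfolding pi1_def PM by (simp add: Q_def)
    also have "\<dots> = (\<integral>y. (\<Prod>k=2..m. measure (M k) (Pair y -` Q k)) \<partial>M 1)"
      by (rule measure_PiM_insert_Collect)
        (use Qs m in \<open>simp_all add: M cong: sets_pair_measure_cong\<close>)
    finally show ?thesis .
  qed
  also have "\<dots> = (\<integral>y. (\<Prod>k=2..m. measure (gamma_distribution (x k)) (Pair y -` Q k))
      \<partial>gamma_distribution (x 1))"
    unfolding M1 by (intro Bochner_Integration.integral_cong prod.cong refl) (simp add: M)
  \<comment> \<open>The outer variable is replaced by its rescaled logarithm; the inner laws are
    transformed afterwards, factor by factor.\<close>
  also have "\<dots> = (\<integral>w. (\<Prod>k=2..m. measure (gamma_distribution (x k))
      (Pair (x 1 * exp (w / sqrt (x 1))) -` Q k)) \<partial>log_gamma_distribution (x 1))"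
  proof (subst gamma_distribution_eq_distr[OF x1], rule integral_distr)
    show "(\<lambda>y. \<Prod>k=2..m. measure (gamma_distribution (x k)) (Pair y -` Q k)) \<in> borel_measurable borel"
      unfolding measure_def
    proof (intro borel_measurable_prod)
      fix k assume k: "k \<in> {2..m}"
      interpret prob_space "gamma_distribution (x k)"
        using k by (intro prob_space_gamma_distribution x) auto
      show "(\<lambda>y. enn2real (emeasure (gamma_distribution (x k)) (Pair y -` Q k))) \<in> borel_measurable borel"
        by (intro borel_measurable_enn2real measurable_emeasure_Pair)
          (use Qs in \<open>simp cong: sets_pair_measure_cong\<close>)
    qed
  qed simp
  also have "\<dots> = (\<integral>w. (\<Prod>k=2..m. 1 - cdf (log_gamma_distribution (x k)) (sqrt (x k / x 1) * w))
    \<partial>log_gamma_distribution (x 1))"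
  proof (intro Bochner_Integration.integral_cong prod.cong refl)
    fix w k assume k: "k \<in> {2..m}"
    then have xk: "x k > 0" by (intro x) auto
    interpret L: prob_space "log_gamma_distribution (x k)"
      by (rule prob_space_log_gamma_distribution) fact
    let ?c = "sqrt (x k / x 1) * w"
    have "measure (gamma_distribution (x k)) (Pair (x 1 * exp (w / sqrt (x 1))) -` Q k) =
        measure (log_gamma_distribution (x k)) {v. exp (w / sqrt (x 1)) < exp (v / sqrt (x k))}"
      using measurable_sets[OF measurable_Pair1' Qs] xk x1
      by (subst gamma_distribution_eq_distr[OF xk], subst measure_distr)
        (auto simp: Q_def intro!: arg_cong2[where f = measure])
    \<comment> \<open>Division by \<open>x 1\<close> and \<open>x k\<close> has already cancelled
      the prefactors of the exponentials. Monotonicity of \<open>exp\<close> leaves a linear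
      inequality, whose strictness makes the set the complement of a closed half-line, as
      \<open>cdf\<close> requires.\<close>
    also have "{v. exp (w / sqrt (x 1)) < exp (v / sqrt (x k))} = UNIV - {..?c}"
      using xk x1 by (auto simp: real_sqrt_divide field_simps)
    also have "measure (log_gamma_distribution (x k)) \<dots> = 1 - cdf (log_gamma_distribution (x k)) ?c"
      using L.prob_compl[of "{..?c}"] by (simp add: cdf_def)
    finally show "measure (gamma_distribution (x k)) (Pair (x 1 * exp (w / sqrt (x 1))) -` Q k) =
        1 - cdf (log_gamma_distribution (x k)) ?c" .
  qed
  finally show ?thesis .
qed

section \<open>Passage to the limit\<close>

theorem theorem28:
  fixes m :: nat and \<alpha> :: "nat \<Rightarrow> real"
  assumes "m \<ge> 2"
    and "\<And>j. j \<in> {1..m} \<Longrightarrow> \<alpha> j > 0"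
  shows "(\<lambda>n. pi1 m (\<lambda>j. \<alpha> j * real n)) \<longlonglongrightarrow>
    (\<integral>z. (\<Prod>k=2..m. 1 - Phi (sqrt (\<alpha> k / \<alpha> 1) * z)) *
          (1 / sqrt (2 * pi)) * exp (- z\<^sup>2 / 2) \<partial>lborel)"
proof -
  \<comment> \<open>Using \<open>max 1 t\<close> keeps all shapes positive, so that measurability
    and the bound by 1 hold for every \<open>t\<close>.\<close>
  define h where "h t w = (\<Prod>k=2..m. 1 - cdf (log_gamma_distribution (\<alpha> k * max 1 t))
    (sqrt (\<alpha> k / \<alpha> 1) * w))" for t w
  define h0 where "h0 w = (\<Prod>k=2..m. 1 - Phi (sqrt (\<alpha> k / \<alpha> 1) * w))" for w
  have \<alpha>1: "\<alpha> 1 > 0" using assms by simp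
  have max1: "filterlim (\<lambda>t :: real. max 1 t) at_top at_top"
    by (rule filterlim_at_top_mono[OF filterlim_ident]) simp
  have D: "real_distribution (log_gamma_distribution (\<alpha> k * max 1 t))" if "k \<in> {2..m}" for k t
    using that assms(2)[of k] by (intro real_distribution_log_gamma_distribution) auto
  have h_meas: "h t \<in> borel_measurable borel" for t
    unfolding h_def [abs_def]
  proof (intro borel_measurable_prod borel_measurable_diff borel_measurable_const)
    fix k assume k: "k \<in> {2..m}"
    interpret real_distribution "log_gamma_distribution (\<alpha> k * max 1 t)" by (rule D[OF k])
    have [measurable]: "cdf (log_gamma_distribution (\<alpha> k * max 1 t)) \<in> borel_measurable borel"
      by (intro borel_measurable_mono monoI cdf_nondecreasing)
    show "(\<lambda>w. cdf (log_gamma_distribution (\<alpha> k * max 1 t)) (sqrt (\<alpha> k / \<alpha> 1) * w))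
        \<in> borel_measurable borel"
      by measurable
  qed
  have h_bound: "\<bar>h t w\<bar> \<le> 1" for t w
  proof -
    have "0 \<le> 1 - cdf (log_gamma_distribution (\<alpha> k * max 1 t)) z \<and>
        1 - cdf (log_gamma_distribution (\<alpha> k * max 1 t)) z \<le> 1" if "k \<in> {2..m}" for k z
    proof -
      interpret real_distribution "log_gamma_distribution (\<alpha> k * max 1 t)" by (rule D[OF that])
      show ?thesis using cdf_bounded_prob[of z] cdf_nonneg[of z] by simp
    qed
    then show ?thesis
      unfolding h_def by (subst abs_of_nonneg) (auto intro!: prod_nonneg prod_le_1)
  qed
  have h_lim: "((\<lambda>t. h t w) \<longlongrightarrow> h0 w) at_top" for w
    unfolding h_def h0_def
    by (intro tendsto_prod tendsto_diff tendsto_const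
        filterlim_compose[OF cdf_log_gamma_distribution_tendsto max1] assms(2)) auto
  have "h0 \<in> borel_measurable borel"
    unfolding h0_def [abs_def] by measurable
  then have "((\<lambda>t. \<integral>w. h t w \<partial>log_gamma_distribution (\<alpha> 1 * t)) \<longlongrightarrow>
      (\<integral>w. h0 w * std_normal_density w \<partial>lborel)) at_top"
    using h_bound by (intro tendsto_integral_log_gamma_distribution h_meas h_lim \<alpha>1) auto
  then have "(\<lambda>n. \<integral>w. h (real n) w \<partial>log_gamma_distribution (\<alpha> 1 * real n)) \<longlonglongrightarrow>
      (\<integral>w. h0 w * std_normal_density w \<partial>lborel)"
    by (rule filterlim_compose[OF _ filterlim_real_sequentially])
  \<comment> \<open>For \<open>n \<ge> 1\<close> the maximum is \<open>real n\<close>, and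
    \<open>n\<close> cancels in the quotient of the shapes, so the slope
    \<open>sqrt (\<alpha> k / \<alpha> 1)\<close> does not depend on \<open>n\<close>. The index 0,
    where all shapes vanish, does not affect the limit.\<close>
  moreover have "eventually (\<lambda>n. (\<integral>w. h (real n) w \<partial>log_gamma_distribution (\<alpha> 1 * real n)) =
      pi1 m (\<lambda>j. \<alpha> j * real n)) sequentially"
    using eventually_ge_at_top[of 1]
  proof eventually_elim
    case (elim n)
    then show ?case
      using assms by (subst pi1_eq_integral_cdf) (auto simp: h_def [abs_def] max_absorb2)
  qed
  ultimately have "(\<lambda>n. pi1 m (\<lambda>j. \<alpha> j * real n)) \<longlonglongrightarrow>
      (\<integral>w. h0 w * std_normal_density w \<partial>lborel)"
    by (rule Lim_transform_eventually)
  then show ?thesis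
    by (simp add: h0_def std_normal_density_def mult_ac)
qed

end
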